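(* Assume that the initial values are $a_{-1}=0$ and $a_0\neq 0$. The inequality $$\left|\alpha-\frac{a_{n+1}}{a_n}\right|\ \ge\ \left|\alpha-\frac{a_{n+2}}{a_{n+1}}\right|$$ holds for every non-negative integer $n$ if and only if $a^2-4b\ge 0$ and $$|\alpha+\beta|=|a|\ge|\beta|.$$
   Context: Let $a,b\in\mathbb{R}$ with $ab\neq 0$. Let $(a_n)_{n\ge -1}$ be the real sequence with the given initial values $a_{-1},a_0$ satisfying $a_{n+2}-a\,a_{n+1}+b\,a_n=0$ for all $n\ge -1$. Put $\alpha_\pm=\frac{a\pm\sqrt{a^2-4b}}{2}$, the roots of $x^2-ax+b$, where $\sqrt{a^2-4b}=\sqrt{-1}\,\sqrt{4b-a^2}$ if $a^2-4b<0$. Let $\alpha,\beta$ denote these two roots labelled so that $\{\alpha,\beta\}=\{\alpha_+,\alpha_-\}$ and $|\alpha|\ge|\beta|$ (either labelling if $|\alpha_+|=|\alpha_-|$). The displayed inequality is understood to include that the denominators $a_n,a_{n+1}$ occurring in it are nonzero. *)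

theory Defs
  imports Complex_Main
begin

text \<open>The square root of the discriminant of \<open>x^2 - a x + b\<close>, as a complex number; for a
  negative discriminant the root with positive imaginary part is chosen.\<close>

definition disc_sqrt :: "real \<Rightarrow> real \<Rightarrow> complex" where
  "disc_sqrt a b =
     (if a\<^sup>2 - 4 * b < 0 then \<i> * complex_of_real (sqrt (4 * b - a\<^sup>2))
      else complex_of_real (sqrt (a\<^sup>2 - 4 * b)))"

definition root_plus :: "real \<Rightarrow> real \<Rightarrow> complex" where
  "root_plus a b = (complex_of_real a + disc_sqrt a b) / 2"

definition root_minus :: "real \<Rightarrow> real \<Rightarrow> complex" where
  "root_minus a b = (complex_of_real a - disc_sqrt a b) / 2"

text \<open>A sequence indexed by the integers \<open>\<ge> -1\<close> is a function on all of \<open>int\<close> whose values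
  below \<open>-1\<close> are unconstrained and never used.\<close>

definition satisfies_recurrence :: "real \<Rightarrow> real \<Rightarrow> (int \<Rightarrow> real) \<Rightarrow> bool" where
  "satisfies_recurrence a b s \<longleftrightarrow> (\<forall>n\<ge>-1. s (n + 2) - a * s (n + 1) + b * s n = 0)"

end

theory Submission
  imports Defs
begin

text \<open>Write \<open>r\<^sub>n = s (n + 1) / s n\<close>. Vieta's formulas turn the recurrence into
  \<open>\<alpha> - r\<^sub>n\<^sub>+\<^sub>1 = \<beta> (\<alpha> - r\<^sub>n) / r\<^sub>n\<close>. Since \<open>s (-1) = 0\<close> gives \<open>r\<^sub>0 = a\<close>, the error starts at
  \<open>\<alpha> - r\<^sub>0 = -\<beta>\<close> and never vanishes; hence the \<open>n\<close>-th error inequality says exactly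
  \<open>\<bar>r\<^sub>n\<bar> \<ge> \<bar>\<beta>\<bar>\<close> (\<open>error_decreases_iff\<close>). For \<open>n = 0\<close> this is the condition \<open>\<bar>a\<bar> \<ge> \<bar>\<beta>\<bar>\<close>.

  Scaling by \<open>a\<close> removes the sign of \<open>a\<close>: the numbers \<open>x\<^sub>n = r\<^sub>n / a\<close> form the orbit of \<open>1\<close>
  under \<open>x \<mapsto> 1 - k / x\<close> with \<open>k = b / a\<^sup>2\<close>, whose fixed points are \<open>\<alpha> / a\<close> and \<open>\<beta> / a\<close>.

  For a negative discriminant, \<open>k > 1/4\<close> and \<open>\<bar>\<beta>\<bar>\<^sup>2 = b\<close>, so the inequalities would give
  \<open>x\<^sub>n\<^sup>2 \<ge> k\<close> for all \<open>n\<close>. This bound keeps the orbit positive, but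
  without a real fixed point the orbit drops by at least \<open>k - 1/4\<close> in each step, which is
  impossible (\<open>elliptic_orbit_violates_bound\<close>).

  For a nonnegative discriminant the fixed points \<open>A\<close> and \<open>B\<close> are real with \<open>A + B = 1\<close> and
  \<open>A \<ge> \<bar>B\<bar>\<close>. The orbit stays in a half-line bounded below by \<open>A\<close> or by \<open>1\<close>, according to the
  sign of \<open>B\<close>, and both of these bounds are at least \<open>\<bar>B\<bar>\<close> (\<open>invariant_half_line\<close>).\<close>

section \<open>The map \<open>x \<mapsto> 1 - k / x\<close>\<close>

text \<open>A positive point with \<open>x \<ge> sqrt k\<close> is sent above \<open>1 - sqrt k > - sqrt k\<close>, so the bound
  \<open>k \<le> (x n)\<^sup>2\<close> forces the image to be at least \<open>sqrt k\<close> again. On the interval \<open>(0, 1]\<close>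
  the map lowers its argument by \<open>(x\<^sup>2 - x + k) / x \<ge> k - 1/4\<close>, so the orbit would have to
  leave the positive half-line.\<close>

lemma elliptic_orbit_violates_bound:
  fixes x :: "nat \<Rightarrow> real"
  assumes x0: "x 0 = 1" and step: "\<And>n. x (Suc n) = 1 - k / x n" and k: "k > 1/4"
  shows "\<exists>n. (x n)\<^sup>2 < k"
proof (rule ccontr)
  assume "\<nexists>n. (x n)\<^sup>2 < k"
  then have sq: "k \<le> (x n)\<^sup>2" for n
    by (simp add: not_less)
  have sqrt_pos: "sqrt k > 0" and sqrt_sq: "sqrt k * sqrt k = k"
    using k by auto
  have abs_ge: "sqrt k \<le> \<bar>x n\<bar>" for n
    using real_sqrt_le_mono[OF sq[of n]] by simp
  have ge: "sqrt k \<le> x n" for n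
  proof (induction n)
    case 0
    show ?case using abs_ge[of 0] x0 by simp
  next
    case (Suc n)
    have "x n > 0" using Suc sqrt_pos by linarith
    then have "k / x n \<le> sqrt k"
      using sqrt_pos sqrt_sq mult_left_mono[OF Suc, of "sqrt k"]
      by (simp add: pos_divide_le_eq)
    then show ?case
      using step[of n] abs_ge[of "Suc n"] by linarith
  qed
  have pos: "x n > 0" for n
    using ge[of n] sqrt_pos by linarith
  have le: "x n \<le> 1 - real n * (k - 1/4)" for n
  proof (induction n)
    case 0
    show ?case using x0 by simp
  next
    case (Suc n)
    have "0 \<le> real n * (k - 1/4)" using k by simp
    then have "x n \<le> 1" using Suc by linarith
    then have "(k - 1/4) * x n \<le> k - 1/4"
      using k mult_left_mono[of "x n" 1 "k - 1/4"] by simp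
    also have "\<dots> \<le> x n * x n - x n + k"
      using zero_le_square[of "x n - 1/2"] by (simp add: algebra_simps)
    finally have "x n * (1 - k / x n) \<le> x n * (x n - (k - 1/4))"
      using pos[of n] by (simp add: algebra_simps)
    then have "x (Suc n) \<le> x n - (k - 1/4)"
      using pos[of n] step[of n] by (simp only: mult_le_cancel_left_pos)
    then show ?case
      using Suc by (simp add: algebra_simps add_divide_distrib)
  qed
  obtain n where "1 < real n * (k - 1/4)"
    using k ex_less_of_nat_mult[of "k - 1/4" 1] by auto
  then show False
    using le[of n] pos[of n] by linarith
qed

text \<open>On the positive half-line the map is increasing for \<open>B > 0\<close>, so the half-line above its fixed
  point \<open>A\<close> is invariant. For \<open>B \<le> 0\<close> it sends every positive number above \<open>1\<close>, and
  \<open>\<bar>B\<bar> \<le> 1\<close> puts \<open>\<bar>B\<bar>\<close> below that bound.\<close>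

lemma invariant_half_line:
  fixes A B :: real
  assumes sum: "A + B = 1" and dom: "\<bar>B\<bar> \<le> \<bar>A\<bar>" and B1: "\<bar>B\<bar> \<le> 1"
  obtains M where "0 < M" "M \<le> 1" "\<bar>B\<bar> \<le> M" "\<And>x. M \<le> x \<Longrightarrow> M \<le> 1 - A * B / x"
proof (cases "B > 0")
  case True
  have A: "0 < A" "A \<le> 1" "\<bar>B\<bar> \<le> A" using sum dom True by linarith+
  have "A \<le> 1 - A * B / x" if "A \<le> x" for x
  proof -
    have "A * B / x \<le> B"
      using that A True by (simp add: divide_le_eq mult.commute)
    then show ?thesis using sum by linarith
  qed
  then show ?thesis using that A by blast
next
  case False
  have "A * B \<le> 0" using sum False by (intro mult_nonneg_nonpos) linarith+
  then have "1 \<le> 1 - A * B / x" if "1 \<le> x" for x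
    using that by (simp add: divide_nonpos_pos)
  then show ?thesis using that[of 1] B1 by simp
qed

section \<open>The roots of the characteristic polynomial\<close>

lemma disc_sqrt_square: "(disc_sqrt a b)\<^sup>2 = complex_of_real (a\<^sup>2 - 4 * b)"
  by (simp add: disc_sqrt_def power_mult_distrib flip: of_real_power)

lemma root_sum: "root_plus a b + root_minus a b = complex_of_real a"
  by (simp add: root_plus_def root_minus_def field_simps)

lemma root_product: "root_plus a b * root_minus a b = complex_of_real b"
proof -
  have "root_plus a b * root_minus a b = ((complex_of_real a)\<^sup>2 - (disc_sqrt a b)\<^sup>2) / 4"
    by (simp add: root_plus_def root_minus_def field_simps power2_eq_square)
  then show ?thesis by (simp add: disc_sqrt_square)
qed

lemma roots_real:
  assumes "a\<^sup>2 - 4 * b \<ge> 0"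
  shows "root_plus a b \<in> \<real>" "root_minus a b \<in> \<real>"
  using assms by (auto simp: root_plus_def root_minus_def disc_sqrt_def)

lemma cmod_roots_elliptic:
  assumes "a\<^sup>2 - 4 * b < 0"
  shows "(cmod (root_plus a b))\<^sup>2 = b" "(cmod (root_minus a b))\<^sup>2 = b"
  using assms
  by (simp_all add: root_plus_def root_minus_def disc_sqrt_def cmod_power2 power_divide
      add_divide_distrib [symmetric])

section \<open>Ratios of consecutive terms\<close>

lemma recurrence_step:
  assumes "satisfies_recurrence a b s" "n \<ge> -1"
  shows "s (n + 2) = a * s (n + 1) - b * s n"
proof -
  have "s (n + 2) - a * s (n + 1) + b * s n = 0"
    using assms unfolding satisfies_recurrence_def by blast
  then show ?thesis by linarith
qed

lemma scaled_ratio_step: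
  assumes "satisfies_recurrence a b s" "n \<ge> -1" "a \<noteq> 0" "s n \<noteq> 0" "s (n + 1) \<noteq> 0"
  shows "s (n + 2) / (a * s (n + 1)) = 1 - (b / a\<^sup>2) / (s (n + 1) / (a * s n))"
  using assms(3-) by (simp add: recurrence_step[OF assms(1,2)] field_simps power2_eq_square)

lemma ratio_error_step:
  fixes \<alpha> \<beta> :: complex
  assumes "satisfies_recurrence a b s" "n \<ge> -1" "s n \<noteq> 0" "s (n + 1) \<noteq> 0"
    and "\<alpha> + \<beta> = complex_of_real a" "\<alpha> * \<beta> = complex_of_real b"
  shows "\<alpha> - complex_of_real (s (n + 2) / s (n + 1))
       = \<beta> * (\<alpha> - complex_of_real (s (n + 1) / s n)) / complex_of_real (s (n + 1) / s n)"
  using assms(3,4)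
  by (simp add: recurrence_step[OF assms(1,2)] field_simps flip: assms(5,6))

text \<open>The first error is \<open>\<alpha> - a = -\<beta>\<close>, and \<open>ratio_error_step\<close> multiplies errors by nonzero
  factors.\<close>

lemma ratio_error_nonzero:
  fixes \<alpha> \<beta> :: complex
  assumes rec: "satisfies_recurrence a b s" and init: "s (-1) = 0"
    and vieta: "\<alpha> + \<beta> = complex_of_real a" "\<alpha> * \<beta> = complex_of_real b" and "\<beta> \<noteq> 0"
    and nz: "\<And>n. n \<ge> 0 \<Longrightarrow> s n \<noteq> 0" and "n \<ge> 0"
  shows "\<alpha> - complex_of_real (s (n + 1) / s n) \<noteq> 0"
  using \<open>n \<ge> 0\<close>
proof (induction n rule: int_ge_induct)
  case base
  have "s 1 = a * s 0"
    using recurrence_step[OF rec, of "-1"] init by simp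
  then have "\<alpha> - complex_of_real (s 1 / s 0) = - \<beta>"
    using nz[of 0] by (simp flip: vieta(1))
  then show ?case using \<open>\<beta> \<noteq> 0\<close> by simp
next
  case (step n)
  then show ?case
    using ratio_error_step[OF rec, of n \<alpha> \<beta>] nz[of n] nz[of "n + 1"] vieta \<open>\<beta> \<noteq> 0\<close>
    by (simp add: add.assoc)
qed

lemma error_decreases_iff:
  fixes \<alpha> \<beta> :: complex
  assumes "satisfies_recurrence a b s" "n \<ge> -1" "s n \<noteq> 0" "s (n + 1) \<noteq> 0"
    and "\<alpha> + \<beta> = complex_of_real a" "\<alpha> * \<beta> = complex_of_real b"
    and nz: "\<alpha> - complex_of_real (s (n + 1) / s n) \<noteq> 0"
  shows "cmod (\<alpha> - complex_of_real (s (n + 1) / s n))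
           \<ge> cmod (\<alpha> - complex_of_real (s (n + 2) / s (n + 1)))
         \<longleftrightarrow> cmod \<beta> \<le> \<bar>s (n + 1) / s n\<bar>"
proof -
  define e where "e = cmod (\<alpha> - complex_of_real (s (n + 1) / s n))"
  define r where "r = \<bar>s (n + 1) / s n\<bar>"
  have pos: "e > 0" "r > 0"
    using assms(3,4) nz by (auto simp: e_def r_def)
  have "cmod (\<alpha> - complex_of_real (s (n + 2) / s (n + 1))) = cmod \<beta> * e / r"
    unfolding ratio_error_step[OF assms(1-6)] norm_divide norm_mult e_def r_def norm_of_real ..
  moreover have "cmod \<beta> * e / r \<le> e \<longleftrightarrow> cmod \<beta> \<le> r"
    using pos by (simp add: divide_le_eq mult.commute)
  ultimately show ?thesis
    unfolding e_def r_def by simp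
qed

section \<open>The monotonicity criterion\<close>

theorem theorem1p7:
  fixes a b :: real and s :: "int \<Rightarrow> real" and \<alpha> \<beta> :: complex
  assumes "a * b \<noteq> 0"
    and "satisfies_recurrence a b s"
    and "{\<alpha>, \<beta>} = {root_plus a b, root_minus a b}"
    and "cmod \<alpha> \<ge> cmod \<beta>"
    and "s (-1) = 0"
    and "s 0 \<noteq> 0"
  shows "(\<forall>n\<ge>0. s n \<noteq> 0 \<and> s (n + 1) \<noteq> 0 \<and>
            cmod (\<alpha> - complex_of_real (s (n + 1) / s n))
              \<ge> cmod (\<alpha> - complex_of_real (s (n + 2) / s (n + 1))))
         \<longleftrightarrow> a\<^sup>2 - 4 * b \<ge> 0 \<and> cmod (\<alpha> + \<beta>) = \<bar>a\<bar> \<and> \<bar>a\<bar> \<ge> cmod \<beta>"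
    (is "?mono \<longleftrightarrow> ?cond")
proof -
  note rec = assms(2)
  have a: "a \<noteq> 0" and b: "b \<noteq> 0" using assms(1) by auto
  have roots: "\<alpha> = root_plus a b \<and> \<beta> = root_minus a b \<or> \<alpha> = root_minus a b \<and> \<beta> = root_plus a b"
    using assms(3) by (simp add: doubleton_eq_iff)
  have vieta: "\<alpha> + \<beta> = complex_of_real a" "\<alpha> * \<beta> = complex_of_real b"
    using roots root_sum[of a b] root_product[of a b] by (auto simp: add.commute mult.commute)
  have \<beta>: "\<beta> \<noteq> 0" using vieta(2) b by auto
  have s1: "s 1 = a * s 0"
    using recurrence_step[OF rec, of "-1"] assms(5) by simp
  define x where "x n = s (n + 1) / (a * s n)" for n
  have x_step: "x (n + 1) = 1 - (b / a\<^sup>2) / x n" if "n \<ge> 0" "s n \<noteq> 0" "s (n + 1) \<noteq> 0" for n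
    using scaled_ratio_step[OF rec _ a, of n] that by (simp add: x_def add.assoc)
  have x0: "x 0 = 1" using s1 a assms(6) by (simp add: x_def)
  have x_abs: "\<bar>s (n + 1) / s n\<bar> = \<bar>a\<bar> * \<bar>x n\<bar>" for n
    using a by (simp add: x_def abs_mult)
  show ?thesis
  proof
    assume mono: ?mono
    then have nz: "s n \<noteq> 0" if "n \<ge> 0" for n using that by blast
    have bound: "cmod \<beta> \<le> \<bar>a\<bar> * \<bar>x n\<bar>" if "n \<ge> 0" for n
      using mono that error_decreases_iff[OF rec, of n \<alpha> \<beta>]
        ratio_error_nonzero[OF rec assms(5) vieta \<beta> nz that] vieta x_abs[of n] nz[of n] nz[of "n + 1"]
      by simp
    have "a\<^sup>2 - 4 * b \<ge> 0"
    proof (rule ccontr)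
      assume "\<not> ?thesis"
      then have neg: "a\<^sup>2 - 4 * b < 0" by simp
      have "(cmod \<beta>)\<^sup>2 = b" using roots cmod_roots_elliptic[OF neg] by auto
      then have b_le: "b \<le> a\<^sup>2 * (x n)\<^sup>2" if "n \<ge> 0" for n
        using power_mono[OF bound[OF that], of 2] by (simp add: power_mult_distrib)
      have "\<exists>n. (x (int n))\<^sup>2 < b / a\<^sup>2"
      proof (rule elliptic_orbit_violates_bound)
        show "x (int (Suc n)) = 1 - (b / a\<^sup>2) / x (int n)" for n
          using x_step[of "int n"] nz by (simp add: add.commute)
        show "b / a\<^sup>2 > 1/4" using neg a by (simp add: field_simps)
      qed (simp add: x0)
      then obtain n where n: "(x (int n))\<^sup>2 < b / a\<^sup>2" ..
      then have "a\<^sup>2 * (x (int n))\<^sup>2 < b" using a by (simp add: field_simps)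
      then show False using b_le[of "int n"] by simp
    qed
    then show ?cond using bound[of 0] x0 vieta(1) by simp
  next
    assume cond: ?cond
    then have "\<alpha> \<in> \<real>" "\<beta> \<in> \<real>" using roots roots_real[of a b] by auto
    then obtain p q where pq: "\<alpha> = complex_of_real p" "\<beta> = complex_of_real q"
      by (auto elim!: Reals_cases)
    have sum: "p + q = a" and prod: "p * q = b"
      using vieta unfolding pq by (simp_all flip: of_real_add of_real_mult)
    have "p / a + q / a = 1" using sum a by (simp add: field_simps)
    moreover have "\<bar>q / a\<bar> \<le> \<bar>p / a\<bar>" "\<bar>q / a\<bar> \<le> 1"
      using assms(4) cond a by (simp_all add: pq divide_right_mono)
    ultimately obtain M where M: "0 < M" "M \<le> 1" "\<bar>q / a\<bar> \<le> M"
        "\<And>y. M \<le> y \<Longrightarrow> M \<le> 1 - (p / a) * (q / a) / y"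
      by (rule invariant_half_line) auto
    have k: "(p / a) * (q / a) = b / a\<^sup>2" by (simp add: prod power2_eq_square)
    have orbit: "s n \<noteq> 0 \<and> M \<le> x n" if "n \<ge> 0" for n
      using that
    proof (induction n rule: int_ge_induct)
      case base
      show ?case using assms(6) x0 M(2) by simp
    next
      case (step n)
      \<comment> \<open>Division by zero gives \<open>0\<close>, so \<open>x n \<noteq> 0\<close> carries \<open>s (n + 1) \<noteq> 0\<close>.\<close>
      then have "s (n + 1) \<noteq> 0" using M(1) by (auto simp: x_def)
      then show ?case using step x_step[of n] M(4)[of "x n", unfolded k] by simp
    qed
    show ?mono
    proof (intro allI impI)
      fix n :: int
      assume n: "n \<ge> 0"
      have nz: "s n \<noteq> 0" "s (n + 1) \<noteq> 0" using orbit n by auto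
      have "\<bar>q / a\<bar> \<le> \<bar>x n\<bar>" using orbit[OF n] M(1,3) by linarith
      then have "cmod \<beta> \<le> \<bar>s (n + 1) / s n\<bar>"
        unfolding x_abs using a by (simp add: pq field_simps)
      then show "s n \<noteq> 0 \<and> s (n + 1) \<noteq> 0 \<and>
            cmod (\<alpha> - complex_of_real (s (n + 1) / s n))
              \<ge> cmod (\<alpha> - complex_of_real (s (n + 2) / s (n + 1)))"
        using error_decreases_iff[OF rec _ nz vieta]
          ratio_error_nonzero[OF rec assms(5) vieta \<beta> _ n] orbit nz n by simp
    qed
  qed
qed

end
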